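(* Let $L$ be a loss function, $n_1<n$, $n_2=n-n_1$, and let $S_j$ be uniformly distributed on the $n_1$-subsets of $N=\{1,\dots,n\}$. Suppose that the (asymptotic) values of $\mathbb{E}[L(\hat y_{S_j,i},y_i)\mid S_j,i]$ and of $\mathbb{E}[L(\hat y_{S_j,i},y_i)L(\hat y_{S_j,i'},y_{i'})\mid S_j,i,i']$ for $i,i'\in S_j^c$ do not depend on the particular realization of $S_j$; call them $\mathsf{e}_i$ and $\mathsf{e}_{i,i'}$ respectively (so $\mathsf{e}_{i,i}=\mathbb{E}[L^2(\hat y_{S_j,i},y_i)\mid S_j,i]$). Then the (asymptotic) values of $\mathbb{E}(\hat\mu_j)$ and $\operatorname{Var}(\hat\mu_j)$ are $$\mathbb{E}(\hat\mu_j)=\frac1n\sum_{i=1}^n\mathsf{e}_i,$$ $$\operatorname{Var}(\hat\mu_j)=\frac{1}{n^2n_2}\Big\{\sum_{i=1}^n\big(n\,\mathsf{e}_{i,i}-n_2\,\mathsf{e}_i^2\big)+\frac{2}{n-1}\sum_{1\le i<i'\le n}\big[n(n_2-1)\mathsf{e}_{i,i'}-(n-1)n_2\,\mathsf{e}_i\mathsf{e}_{i'}\big]\Big\}.$$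
   Context: Data $(y_i,\mathbf{x}_i)$, $i=1,\dots,n$. For a training index set $S_j$, $\hat y_{S_j,i}$ is the prediction for observation $i$ of the rule fitted on $\{(y_k,\mathbf{x}_k):k\in S_j\}$, and the average test set error is $\hat\mu_j=\frac{1}{n_2}\sum_{i\in S_j^c}L(\hat y_{S_j,i},y_i)$. *)

theory Defs
  imports "HOL-Probability.Probability"
begin

definition mu_hat :: "('y \<Rightarrow> 'y \<Rightarrow> real) \<Rightarrow> (nat set \<Rightarrow> nat \<Rightarrow> 'w \<Rightarrow> 'y) \<Rightarrow>
    (nat \<Rightarrow> 'w \<Rightarrow> 'y) \<Rightarrow> nat \<Rightarrow> nat \<Rightarrow> nat set \<Rightarrow> 'w \<Rightarrow> real" where
  "mu_hat L yhat y n n2 S w =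
     (1 / real n2) * (\<Sum>i\<in>{1..n} - S. L (yhat S i w) (y i w))"

end

theory Submission
  imports Defs
begin

text \<open>Partition the sample space according to the realised split \<open>S\<close>: each of the
  \<open>n choose n1\<close> splits has probability \<open>1 / (n choose n1)\<close>, and on the cell of a split \<open>s\<close> the
  hypotheses give the integrals of the held-out losses and of their products. Hence \<open>E \<mu>\<close> and
  \<open>E \<mu>\<^sup>2\<close> are averages over all splits of \<open>\<Sum>i\<notin>s. e i\<close> and \<open>\<Sum>i,i'\<notin>s. ee i i'\<close>. By double
  counting, an index is held out by \<open>(n-1) choose n1\<close> splits and a pair of distinct indices by
  \<open>(n-2) choose n1\<close>, and the absorption identity turns the ratios of these binomials into
  \<open>n2/n\<close> and \<open>n2 (n2-1) / (n (n-1))\<close>. The variance is \<open>E \<mu>\<^sup>2 - (E \<mu>)\<^sup>2\<close>; writing it over pairs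
  \<open>i < i'\<close> uses \<open>ee i i' = ee i' i\<close>, which follows from the hypotheses when \<open>n2 \<ge> 2\<close>, while
  for \<open>n2 = 1\<close> the off-diagonal terms carry the factor \<open>n2 - 1 = 0\<close>.\<close>

lemma card_subsets_disjoint:
  assumes "finite N" "T \<subseteq> N"
  shows "card {s. s \<subseteq> N \<and> card s = k \<and> s \<inter> T = {}} = (card N - card T) choose k"
proof -
  have "{s. s \<subseteq> N \<and> card s = k \<and> s \<inter> T = {}} = {s. s \<subseteq> N - T \<and> card s = k}"
    by auto
  then show ?thesis
    using n_subsets[of "N - T" k] assms by (simp add: card_Diff_subset finite_subset)
qed

lemma sum_sum_filter_swap:
  assumes "finite V" "finite I"
  shows "(\<Sum>s\<in>V. \<Sum>i | i \<in> I \<and> P s i. g i) = (\<Sum>i\<in>I. of_nat (card {s\<in>V. P s i}) * g i)"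
proof -
  have "(\<Sum>s\<in>V. \<Sum>i | i \<in> I \<and> P s i. g i) = (\<Sum>s\<in>V. \<Sum>i\<in>I. if P s i then g i else 0)"
    using assms(2) by (simp add: sum.inter_filter[symmetric])
  also have "\<dots> = (\<Sum>i\<in>I. \<Sum>s\<in>V. if P s i then g i else 0)"
    by (rule sum.swap)
  also have "\<dots> = (\<Sum>i\<in>I. of_nat (card {s\<in>V. P s i}) * g i)"
    using assms(1) by (simp add: sum.If_cases Int_def)
  finally show ?thesis .
qed

lemma sum_subsets_sum_compl:
  fixes g :: "'a \<Rightarrow> 'b::comm_semiring_1"
  assumes "finite N"
  shows "(\<Sum>s | s \<subseteq> N \<and> card s = k. \<Sum>i\<in>N - s. g i)
           = of_nat ((card N - 1) choose k) * (\<Sum>i\<in>N. g i)"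
proof -
  let ?V = "{s. s \<subseteq> N \<and> card s = k}"
  have "(\<Sum>s\<in>?V. \<Sum>i\<in>N - s. g i) = (\<Sum>i\<in>N. of_nat (card {s\<in>?V. i \<notin> s}) * g i)"
    using sum_sum_filter_swap[where V = ?V and I = N and P = "\<lambda>s i. i \<notin> s" and g = g] assms
    by (simp add: set_diff_eq)
  also have "\<dots> = (\<Sum>i\<in>N. of_nat ((card N - 1) choose k) * g i)"
  proof (rule sum.cong[OF refl])
    fix i assume "i \<in> N"
    have "{s \<in> ?V. i \<notin> s} = {s. s \<subseteq> N \<and> card s = k \<and> s \<inter> {i} = {}}" by auto
    then show "of_nat (card {s \<in> ?V. i \<notin> s}) * g i = of_nat ((card N - 1) choose k) * g i"
      using card_subsets_disjoint[of N "{i}" k] assms \<open>i \<in> N\<close> by simp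
  qed
  finally show ?thesis by (simp add: sum_distrib_left)
qed

lemma sum_subsets_sum_compl_pairs:
  fixes g :: "'a \<Rightarrow> 'a \<Rightarrow> 'b::comm_semiring_1"
  assumes "finite N"
  shows "(\<Sum>s | s \<subseteq> N \<and> card s = k. \<Sum>i\<in>N - s. \<Sum>i'\<in>N - s. g i i')
           = of_nat ((card N - 1) choose k) * (\<Sum>i\<in>N. g i i)
             + of_nat ((card N - 2) choose k) * (\<Sum>i\<in>N. \<Sum>i'\<in>N - {i}. g i i')"
proof -
  let ?V = "{s. s \<subseteq> N \<and> card s = k}"
  let ?c = "\<lambda>i i'. of_nat (card {s\<in>?V. s \<inter> {i, i'} = {}}) :: 'b"
  have "(\<Sum>s\<in>?V. \<Sum>i\<in>N - s. \<Sum>i'\<in>N - s. g i i')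
          = (\<Sum>s\<in>?V. \<Sum>p | p \<in> N \<times> N \<and> {fst p, snd p} \<inter> s = {}. g (fst p) (snd p))"
  proof (rule sum.cong[OF refl])
    fix s
    have "{p. p \<in> N \<times> N \<and> {fst p, snd p} \<inter> s = {}} = (N - s) \<times> (N - s)" by auto
    then show "(\<Sum>i\<in>N - s. \<Sum>i'\<in>N - s. g i i')
        = (\<Sum>p | p \<in> N \<times> N \<and> {fst p, snd p} \<inter> s = {}. g (fst p) (snd p))"
      by (simp add: sum.cartesian_product split_beta)
  qed
  also have "\<dots> = (\<Sum>p\<in>N \<times> N. ?c (fst p) (snd p) * g (fst p) (snd p))"
    using assms by (subst sum_sum_filter_swap) (auto simp: Int_commute)
  also have "\<dots> = (\<Sum>i\<in>N. \<Sum>i'\<in>N. ?c i i' * g i i')"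
    by (simp add: sum.cartesian_product split_beta)
  also have "\<dots> = (\<Sum>i\<in>N. ?c i i * g i i + (\<Sum>i'\<in>N - {i}. ?c i i' * g i i'))"
    using assms by (intro sum.cong[OF refl]) (simp add: sum.remove)
  also have "\<dots> = (\<Sum>i\<in>N. of_nat ((card N - 1) choose k) * g i i
                       + (\<Sum>i'\<in>N - {i}. of_nat ((card N - 2) choose k) * g i i'))"
  proof (intro sum.cong refl arg_cong2[where f = "(+)"])
    fix i i' assume "i \<in> N" "i' \<in> N - {i}"
    then show "?c i i' * g i i' = of_nat ((card N - 2) choose k) * g i i'"
      using card_subsets_disjoint[of N "{i, i'}" k] assms
      by (auto simp: card_insert_if numeral_2_eq_2)
  next
    fix i assume "i \<in> N"
    then show "?c i i * g i i = of_nat ((card N - 1) choose k) * g i i"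
      using card_subsets_disjoint[of N "{i}" k] assms by simp
  qed
  finally show ?thesis by (simp add: sum.distrib sum_distrib_left)
qed

lemma choose_diff_two_absorb:
  "(n - k) * (n - k - 1) * (n choose k) = n * (n - 1) * ((n - 2) choose k)"
proof -
  have "(n - k) * (n - k - 1) * (n choose k) = (n - 1 - k) * (n * ((n - 1) choose k))"
    by (simp add: binomial_absorb_comp diff_commute)
  also have "\<dots> = n * ((n - 1) * ((n - 1 - 1) choose k))"
    using binomial_absorb_comp[of "n - 1" k] by simp
  finally show ?thesis by (simp add: numeral_2_eq_2)
qed

lemma sum_off_diagonal_atLeastAtMost:
  fixes h :: "nat \<Rightarrow> nat \<Rightarrow> 'a::comm_monoid_add"
  shows "(\<Sum>i=1..n. \<Sum>i'\<in>{1..n} - {i}. h i i') = (\<Sum>i=1..n. \<Sum>i'=i+1..n. h i i' + h i' i)"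
proof (induction n)
  case 0
  then show ?case by simp
next
  case (Suc n)
  have "(\<Sum>i=1..Suc n. \<Sum>i'\<in>{1..Suc n} - {i}. h i i')
        = (\<Sum>i=1..n. (\<Sum>i'\<in>{1..n} - {i}. h i i') + h i (Suc n)) + (\<Sum>i'=1..n. h (Suc n) i')"
    by (simp add: atLeastAtMostSuc_conv insert_Diff_if sum.distrib add_ac)
  also have "\<dots> = (\<Sum>i=1..n. \<Sum>i'=i+1..n. h i i' + h i' i) + (\<Sum>i=1..n. h i (Suc n) + h (Suc n) i)"
    by (simp only: sum.distrib Suc.IH add.assoc)
  also have "\<dots> = (\<Sum>i=1..Suc n. \<Sum>i'=i+1..Suc n. h i i' + h i' i)"
    by (simp add: sum.distrib add_ac)
  finally show ?case .
qed

lemma power2_sum_off_diagonal: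
  fixes e :: "'a \<Rightarrow> 'b::comm_ring_1"
  assumes "finite N"
  shows "(\<Sum>i\<in>N. e i)\<^sup>2 = (\<Sum>i\<in>N. (e i)\<^sup>2) + (\<Sum>i\<in>N. \<Sum>i'\<in>N - {i}. e i * e i')"
proof -
  have "(\<Sum>i\<in>N. e i)\<^sup>2 = (\<Sum>i\<in>N. \<Sum>i'\<in>N. e i * e i')"
    by (simp add: power2_eq_square sum_product)
  also have "\<dots> = (\<Sum>i\<in>N. e i * e i + (\<Sum>i'\<in>N - {i}. e i * e i'))"
    using assms by (intro sum.cong[OF refl]) (simp add: sum.remove)
  finally show ?thesis by (simp add: sum.distrib power2_eq_square)
qed

lemma
  fixes g :: "'s \<Rightarrow> 'w \<Rightarrow> real"
  assumes "finite V"
    and S: "\<And>w. w \<in> space M \<Longrightarrow> S w \<in> V"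
    and "\<And>s. {w \<in> space M. S w = s} \<in> sets M"
    and g: "\<And>s. s \<in> V \<Longrightarrow> integrable M (g s)"
  shows integrable_finite_partition: "integrable M (\<lambda>w. g (S w) w)"
    and integral_finite_partition:
      "(\<integral>w. g (S w) w \<partial>M) = (\<Sum>s\<in>V. \<integral>w. indicator {w \<in> space M. S w = s} w * g s w \<partial>M)"
proof -
  have cells: "integrable M (\<lambda>w. indicator {w \<in> space M. S w = s} w * g s w)" if "s \<in> V" for s
    using integrable_mult_indicator[OF assms(3) g[OF that]] by simp
  have split: "g (S w) w = (\<Sum>s\<in>V. indicator {w \<in> space M. S w = s} w * g s w)"
    if "w \<in> space M" for w
  proof -
    have "(\<Sum>s\<in>V. indicator {w \<in> space M. S w = s} w * g s w) = (\<Sum>s\<in>V. if s = S w then g s w else 0)"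
      using that by (intro sum.cong[OF refl]) (auto simp: indicator_def)
    then show ?thesis using S[OF that] \<open>finite V\<close> by simp
  qed
  show "integrable M (\<lambda>w. g (S w) w)"
    using cells by (subst Bochner_Integration.integrable_cong[OF refl split]) auto
  show "(\<integral>w. g (S w) w \<partial>M) = (\<Sum>s\<in>V. \<integral>w. indicator {w \<in> space M. S w = s} w * g s w \<partial>M)"
    using cells
    by (subst Bochner_Integration.integral_cong[OF refl split]) (auto intro!: integral_sum)
qed

lemma integral_indicator_sum:
  fixes f :: "'i \<Rightarrow> 'w \<Rightarrow> real"
  assumes "A \<in> sets M" "\<And>i. i \<in> I \<Longrightarrow> integrable M (f i)"
  shows "(\<integral>w. indicator A w * (\<Sum>i\<in>I. f i w) \<partial>M) = (\<Sum>i\<in>I. \<integral>w. indicator A w * f i w \<partial>M)"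
  using integrable_mult_indicator[OF assms(1) assms(2)]
  by (simp add: sum_distrib_left Bochner_Integration.integral_sum)

locale random_holdout_split = prob_space M
  for M :: "'w measure"
    and L :: "'y \<Rightarrow> 'y \<Rightarrow> real"
    and yhat :: "nat set \<Rightarrow> nat \<Rightarrow> 'w \<Rightarrow> 'y"
    and y :: "nat \<Rightarrow> 'w \<Rightarrow> 'y"
    and S :: "'w \<Rightarrow> nat set"
    and e :: "nat \<Rightarrow> real"
    and ee :: "nat \<Rightarrow> nat \<Rightarrow> real"
    and n n1 n2 :: nat +
  assumes n1_less: "n1 < n"
    and n2_eq: "n2 = n - n1"
    and S_split: "w \<in> space M \<Longrightarrow> S w \<subseteq> {1..n} \<and> card (S w) = n1"
    and S_events: "{w \<in> space M. S w = s} \<in> events"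
    and S_uniform: "s \<subseteq> {1..n} \<Longrightarrow> card s = n1 \<Longrightarrow>
        prob {w \<in> space M. S w = s} = 1 / real (n choose n1)"
    and loss_integrable: "s \<subseteq> {1..n} \<Longrightarrow> card s = n1 \<Longrightarrow> i \<in> {1..n} - s \<Longrightarrow>
        integrable M (\<lambda>w. L (yhat s i w) (y i w))"
    and loss_product_integrable: "s \<subseteq> {1..n} \<Longrightarrow> card s = n1 \<Longrightarrow> i \<in> {1..n} - s \<Longrightarrow>
        i' \<in> {1..n} - s \<Longrightarrow> integrable M (\<lambda>w. L (yhat s i w) (y i w) * L (yhat s i' w) (y i' w))"
    and loss_cell_integral: "s \<subseteq> {1..n} \<Longrightarrow> card s = n1 \<Longrightarrow> i \<in> {1..n} - s \<Longrightarrow>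
        (\<integral>w. indicator {w \<in> space M. S w = s} w * L (yhat s i w) (y i w) \<partial>M)
          = e i * prob {w \<in> space M. S w = s}"
    and loss_product_cell_integral: "s \<subseteq> {1..n} \<Longrightarrow> card s = n1 \<Longrightarrow> i \<in> {1..n} - s \<Longrightarrow>
        i' \<in> {1..n} - s \<Longrightarrow>
        (\<integral>w. indicator {w \<in> space M. S w = s} w *
             (L (yhat s i w) (y i w) * L (yhat s i' w) (y i' w)) \<partial>M)
          = ee i i' * prob {w \<in> space M. S w = s}"
begin

abbreviation splits :: "nat set set" where
  "splits \<equiv> {s. s \<subseteq> {1..n} \<and> card s = n1}"

abbreviation loss :: "nat set \<Rightarrow> nat \<Rightarrow> 'w \<Rightarrow> real" where
  "loss s i w \<equiv> L (yhat s i w) (y i w)"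

abbreviation holdout_error :: "'w \<Rightarrow> real" where
  "holdout_error w \<equiv> mu_hat L yhat y n n2 (S w) w"

lemma finite_splits: "finite splits"
  by simp

lemma S_in_splits: "w \<in> space M \<Longrightarrow> S w \<in> splits"
  using S_split by simp

lemma n2_pos: "n2 > 0"
  using n1_less n2_eq by simp

lemma mu_hat_eq: "mu_hat L yhat y n n2 s w = 1 / real n2 * (\<Sum>i\<in>{1..n} - s. loss s i w)"
  by (simp add: mu_hat_def)

lemma mu_hat_square_eq:
  "(mu_hat L yhat y n n2 s w)\<^sup>2
     = 1 / (real n2)\<^sup>2 * (\<Sum>i\<in>{1..n} - s. \<Sum>i'\<in>{1..n} - s. loss s i w * loss s i' w)"
  by (simp add: mu_hat_eq power2_eq_square sum_product)

lemma integrable_mu_hat: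
  assumes "s \<in> splits"
  shows "integrable M (mu_hat L yhat y n n2 s)"
  unfolding mu_hat_eq using assms
  by (intro integrable_mult_right Bochner_Integration.integrable_sum loss_integrable) auto

lemma integrable_mu_hat_square:
  assumes "s \<in> splits"
  shows "integrable M (\<lambda>w. (mu_hat L yhat y n n2 s w)\<^sup>2)"
  unfolding mu_hat_square_eq using assms
  by (intro integrable_mult_right Bochner_Integration.integrable_sum loss_product_integrable) auto

lemma cell_integral_mu_hat:
  assumes "s \<in> splits"
  shows "(\<integral>w. indicator {w \<in> space M. S w = s} w * mu_hat L yhat y n n2 s w \<partial>M)
           = (\<Sum>i\<in>{1..n} - s. e i) / (real n2 * real (n choose n1))"
proof -
  have "(\<integral>w. indicator {w \<in> space M. S w = s} w * mu_hat L yhat y n n2 s w \<partial>M)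
          = 1 / real n2 * (\<Sum>i\<in>{1..n} - s. \<integral>w. indicator {w \<in> space M. S w = s} w * loss s i w \<partial>M)"
    unfolding mu_hat_eq mult.left_commute[of _ "1 / real n2"] integral_mult_right_zero
    using assms by (subst integral_indicator_sum) (auto intro!: S_events loss_integrable)
  also have "\<dots> = 1 / real n2 * (\<Sum>i\<in>{1..n} - s. e i / real (n choose n1))"
    using assms by (simp add: loss_cell_integral S_uniform)
  finally show ?thesis
    by (simp add: sum_divide_distrib[symmetric])
qed

lemma cell_integral_mu_hat_square:
  assumes "s \<in> splits"
  shows "(\<integral>w. indicator {w \<in> space M. S w = s} w * (mu_hat L yhat y n n2 s w)\<^sup>2 \<partial>M)
           = (\<Sum>i\<in>{1..n} - s. \<Sum>i'\<in>{1..n} - s. ee i i') / ((real n2)\<^sup>2 * real (n choose n1))"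
proof -
  let ?A = "{w \<in> space M. S w = s}"
  have "(\<integral>w. indicator ?A w * (mu_hat L yhat y n n2 s w)\<^sup>2 \<partial>M)
          = 1 / (real n2)\<^sup>2 * (\<Sum>i\<in>{1..n} - s.
              \<integral>w. indicator ?A w * (\<Sum>i'\<in>{1..n} - s. loss s i w * loss s i' w) \<partial>M)"
    unfolding mu_hat_square_eq mult.left_commute[of _ "1 / (real n2)\<^sup>2"] integral_mult_right_zero
    using assms
    by (subst integral_indicator_sum)
      (auto intro!: S_events Bochner_Integration.integrable_sum loss_product_integrable)
  also have "\<dots> = 1 / (real n2)\<^sup>2 * (\<Sum>i\<in>{1..n} - s. \<Sum>i'\<in>{1..n} - s.
              \<integral>w. indicator ?A w * (loss s i w * loss s i' w) \<partial>M)"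
    using assms by (intro arg_cong2[where f = "(*)"] refl sum.cong integral_indicator_sum)
      (auto intro!: S_events loss_product_integrable)
  also have "\<dots>
      = 1 / (real n2)\<^sup>2 * (\<Sum>i\<in>{1..n} - s. \<Sum>i'\<in>{1..n} - s. ee i i' / real (n choose n1))"
    using assms by (simp add: loss_product_cell_integral S_uniform)
  finally show ?thesis
    by (simp add: sum_divide_distrib[symmetric])
qed

lemma real_choose_minus_one: "real ((n - 1) choose n1) * real n = real (n choose n1) * real n2"
  using binomial_absorb_comp[of n n1] n2_eq by (metis mult.commute of_nat_mult)

lemma real_choose_minus_two:
  "real ((n - 2) choose n1) * (real n * (real n - 1))
     = real (n choose n1) * (real n2 * (real n2 - 1))"
proof -
  have "real n2 * (real n2 - 1) = real ((n - n1) * (n - n1 - 1))"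
    using n2_pos n2_eq by (simp add: of_nat_diff)
  moreover have "real n * (real n - 1) = real (n * (n - 1))"
    using n1_less by (simp add: of_nat_diff)
  ultimately show ?thesis
    using choose_diff_two_absorb[of n n1] by (metis mult.commute of_nat_mult)
qed

lemma
  shows integrable_holdout_error: "integrable M holdout_error"
    and expectation_holdout_error: "expectation holdout_error = 1 / real n * (\<Sum>i=1..n. e i)"
proof -
  show "integrable M holdout_error"
    by (rule integrable_finite_partition[OF finite_splits S_in_splits S_events integrable_mu_hat])
  have "expectation holdout_error
          = (\<Sum>s\<in>splits. \<integral>w. indicator {w \<in> space M. S w = s} w * mu_hat L yhat y n n2 s w \<partial>M)"
    by (rule integral_finite_partition[OF finite_splits S_in_splits S_events integrable_mu_hat])
  also have "\<dots> = (\<Sum>s\<in>splits. (\<Sum>i\<in>{1..n} - s. e i) / (real n2 * real (n choose n1)))"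
    by (rule sum.cong[OF refl], rule cell_integral_mu_hat)
  also have "\<dots> = real ((n - 1) choose n1) * (\<Sum>i=1..n. e i) / (real n2 * real (n choose n1))"
    by (simp add: sum_divide_distrib[symmetric] sum_subsets_sum_compl)
  also have "\<dots> = 1 / real n * (\<Sum>i=1..n. e i)"
    using real_choose_minus_one n2_pos n1_less by (simp add: field_simps)
  finally show "expectation holdout_error = 1 / real n * (\<Sum>i=1..n. e i)" .
qed

lemma
  shows integrable_holdout_error_square: "integrable M (\<lambda>w. (holdout_error w)\<^sup>2)"
    and second_moment_holdout_error: "expectation (\<lambda>w. (holdout_error w)\<^sup>2)
          = (\<Sum>i=1..n. ee i i) / (real n * real n2)
            + (real n2 - 1) / (real n * real n2 * (real n - 1))
              * (\<Sum>i=1..n. \<Sum>i'\<in>{1..n} - {i}. ee i i')"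
proof -
  let ?g = "\<lambda>s w. (mu_hat L yhat y n n2 s w)\<^sup>2"
  let ?C = "real (n choose n1)"
  let ?D = "\<Sum>i=1..n. ee i i"
  let ?O = "\<Sum>i=1..n. \<Sum>i'\<in>{1..n} - {i}. ee i i'"
  note partition = finite_splits S_in_splits S_events integrable_mu_hat_square
  show "integrable M (\<lambda>w. (holdout_error w)\<^sup>2)"
    by (rule integrable_finite_partition[where g = ?g, OF partition])
  have "expectation (\<lambda>w. (holdout_error w)\<^sup>2)
          = (\<Sum>s\<in>splits. \<integral>w. indicator {w \<in> space M. S w = s} w * ?g s w \<partial>M)"
    by (rule integral_finite_partition[where g = ?g, OF partition])
  also have "\<dots> = (\<Sum>s\<in>splits. (\<Sum>i\<in>{1..n} - s. \<Sum>i'\<in>{1..n} - s. ee i i') / ((real n2)\<^sup>2 * ?C))"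
    by (rule sum.cong[OF refl], rule cell_integral_mu_hat_square)
  also have "\<dots>
      = (real ((n - 1) choose n1) * ?D + real ((n - 2) choose n1) * ?O) / ((real n2)\<^sup>2 * ?C)"
    by (simp add: sum_divide_distrib[symmetric] sum_subsets_sum_compl_pairs)
  also have "\<dots> = ?D / (real n * real n2) + (real n2 - 1) / (real n * real n2 * (real n - 1)) * ?O"
  proof (cases "n = 1")
    case True
    then show ?thesis
      using n1_less n2_eq by simp
  next
    case False
    then have "real n - 1 \<noteq> 0" "real n \<noteq> 0"
      using n1_less by auto
    then have C1: "real ((n - 1) choose n1) = ?C * real n2 / real n"
      and C2: "real ((n - 2) choose n1) = ?C * (real n2 * (real n2 - 1)) / (real n * (real n - 1))"
      using real_choose_minus_one real_choose_minus_two by (simp_all add: field_simps)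
    show ?thesis
      unfolding C1 C2 using \<open>real n - 1 \<noteq> 0\<close> n2_pos n1_less
      by (simp add: field_simps power2_eq_square)
  qed
  finally show "expectation (\<lambda>w. (holdout_error w)\<^sup>2)
          = ?D / (real n * real n2) + (real n2 - 1) / (real n * real n2 * (real n - 1)) * ?O" .
qed

lemma pair_moment_sym:
  assumes "n1 + 2 \<le> n" "i \<in> {1..n}" "i' \<in> {1..n}"
  shows "ee i i' = ee i' i"
proof (cases "i = i'")
  case False
  have "n1 \<le> card ({1..n} - {i, i'})"
    using assms False by (simp add: card_Diff_subset)
  then obtain s where s: "s \<subseteq> {1..n} - {i, i'}" "card s = n1"
    by (meson obtain_subset_with_card_n)
  then have "ee i i' * prob {w \<in> space M. S w = s} = ee i' i * prob {w \<in> space M. S w = s}"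
    using assms loss_product_cell_integral[of s i i'] loss_product_cell_integral[of s i' i]
    by (auto simp: mult.commute)
  moreover have "prob {w \<in> space M. S w = s} \<noteq> 0"
  proof -
    have "s \<subseteq> {1..n}"
      using s(1) by blast
    then show ?thesis
      using S_uniform[of s] s(2) n1_less by simp
  qed
  ultimately show ?thesis
    by simp
qed simp

lemma pair_moment_sum_off_diagonal:
  "(real n2 - 1) * (\<Sum>i=1..n. \<Sum>i'\<in>{1..n} - {i}. ee i i')
     = (real n2 - 1) * (2 * (\<Sum>i=1..n. \<Sum>i'=i+1..n. ee i i'))"
proof (cases "n1 + 2 \<le> n")
  case True
  have "(\<Sum>i=1..n. \<Sum>i'\<in>{1..n} - {i}. ee i i') = (\<Sum>i=1..n. \<Sum>i'=i+1..n. ee i i' + ee i' i)"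
    by (rule sum_off_diagonal_atLeastAtMost)
  also have "\<dots> = (\<Sum>i=1..n. \<Sum>i'=i+1..n. 2 * ee i i')"
    using pair_moment_sym[OF True] by (intro sum.cong refl) auto
  finally show ?thesis
    by (simp add: sum_distrib_left)
next
  case False
  then have "n2 = 1"
    using n1_less n2_eq by simp
  then show ?thesis
    by simp
qed

lemma variance_holdout_error:
  "variance holdout_error = (1 / (real n ^ 2 * real n2)) *
     ((\<Sum>i=1..n. real n * ee i i - real n2 * (e i)\<^sup>2)
      + (2 / (real n - 1)) *
        (\<Sum>i=1..n. \<Sum>i'=i+1..n.
           real n * (real n2 - 1) * ee i i' - (real n - 1) * real n2 * e i * e i'))"
proof -
  define D where "D = (\<Sum>i=1..n. ee i i)"
  define T where "T = (\<Sum>i=1..n. \<Sum>i'=i+1..n. ee i i')"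
  define E2 where "E2 = (\<Sum>i=1..n. (e i)\<^sup>2)"
  define U where "U = (\<Sum>i=1..n. \<Sum>i'=i+1..n. e i * e i')"
  have second_moment: "expectation (\<lambda>w. (holdout_error w)\<^sup>2)
      = D / (real n * real n2) + (real n2 - 1) * (2 * T) / (real n * real n2 * (real n - 1))"
    using pair_moment_sum_off_diagonal
    by (simp add: second_moment_holdout_error D_def T_def)
  have "(\<Sum>i=1..n. e i)\<^sup>2 = E2 + (\<Sum>i=1..n. \<Sum>i'\<in>{1..n} - {i}. e i * e i')"
    unfolding E2_def by (rule power2_sum_off_diagonal) simp
  also have "\<dots> = E2 + 2 * U"
    unfolding sum_off_diagonal_atLeastAtMost U_def by (simp add: sum_distrib_left mult.commute)
  finally have square_mean: "(expectation holdout_error)\<^sup>2 = (E2 + 2 * U) / (real n)\<^sup>2"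
    by (simp add: expectation_holdout_error power_divide)
  have diagonal: "(\<Sum>i=1..n. real n * ee i i - real n2 * (e i)\<^sup>2) = real n * D - real n2 * E2"
    unfolding D_def E2_def by (simp add: sum_subtractf sum_distrib_left)
  have off_diagonal: "(\<Sum>i=1..n. \<Sum>i'=i+1..n.
        real n * (real n2 - 1) * ee i i' - (real n - 1) * real n2 * e i * e i')
      = real n * (real n2 - 1) * T - (real n - 1) * real n2 * U"
    unfolding T_def U_def by (simp add: sum_subtractf sum_distrib_left mult.assoc)
  have variance_moments: "variance holdout_error
      = D / (real n * real n2) + (real n2 - 1) * (2 * T) / (real n * real n2 * (real n - 1))
        - (E2 + 2 * U) / (real n)\<^sup>2"
    using variance_eq[OF integrable_holdout_error integrable_holdout_error_square]
    by (simp add: second_moment square_mean)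
  show ?thesis
  proof (cases "n = 1")
    case True
    then have "T = 0" "U = 0"
      unfolding T_def U_def by simp_all
    with True n2_pos show ?thesis
      unfolding variance_moments diagonal off_diagonal by (simp add: diff_divide_distrib)
  next
    case False
    then have "real n - 1 \<noteq> 0"
      by simp
    with n2_pos n1_less show ?thesis
      unfolding variance_moments diagonal off_diagonal by (simp add: field_simps power2_eq_square)
  qed
qed

end

theorem theorem3:
  fixes M :: "'w measure"
    and L :: "'y \<Rightarrow> 'y \<Rightarrow> real"
    and yhat :: "nat set \<Rightarrow> nat \<Rightarrow> 'w \<Rightarrow> 'y"
    and y :: "nat \<Rightarrow> 'w \<Rightarrow> 'y"
    and S :: "'w \<Rightarrow> nat set"
    and e :: "nat \<Rightarrow> real"
    and ee :: "nat \<Rightarrow> nat \<Rightarrow> real"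
    and n n1 n2 :: nat
  assumes P: "prob_space M"
    and n1_lt: "n1 < n"
    and n2_def: "n2 = n - n1"
    and S_range: "\<forall>w\<in>space M. S w \<subseteq> {1..n} \<and> card (S w) = n1"
    and S_meas: "\<forall>s. {w \<in> space M. S w = s} \<in> sets M"
    and S_unif: "\<forall>s. s \<subseteq> {1..n} \<and> card s = n1 \<longrightarrow>
                   measure M {w \<in> space M. S w = s} = 1 / real (n choose n1)"
    and L_int: "\<forall>s i. s \<subseteq> {1..n} \<and> card s = n1 \<and> i \<in> {1..n} - s \<longrightarrow>
                   integrable M (\<lambda>w. L (yhat s i w) (y i w))"
    and LL_int: "\<forall>s i i'. s \<subseteq> {1..n} \<and> card s = n1 \<and> i \<in> {1..n} - s \<and> i' \<in> {1..n} - s \<longrightarrow>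
                   integrable M (\<lambda>w. L (yhat s i w) (y i w) * L (yhat s i' w) (y i' w))"
    and cond_e: "\<forall>s i. s \<subseteq> {1..n} \<and> card s = n1 \<and> i \<in> {1..n} - s \<longrightarrow>
                   (\<integral>w. indicator {w \<in> space M. S w = s} w * L (yhat s i w) (y i w) \<partial>M)
                     = e i * measure M {w \<in> space M. S w = s}"
    and cond_ee: "\<forall>s i i'. s \<subseteq> {1..n} \<and> card s = n1 \<and> i \<in> {1..n} - s \<and> i' \<in> {1..n} - s \<longrightarrow>
                   (\<integral>w. indicator {w \<in> space M. S w = s} w *
                        (L (yhat s i w) (y i w) * L (yhat s i' w) (y i' w)) \<partial>M)
                     = ee i i' * measure M {w \<in> space M. S w = s}"
  shows "prob_space.expectation M (\<lambda>w. mu_hat L yhat y n n2 (S w) w)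
           = (1 / real n) * (\<Sum>i=1..n. e i)
       \<and> prob_space.variance M (\<lambda>w. mu_hat L yhat y n n2 (S w) w)
           = (1 / (real n ^ 2 * real n2)) *
             ((\<Sum>i=1..n. real n * ee i i - real n2 * (e i)\<^sup>2)
              + (2 / (real n - 1)) *
                (\<Sum>i=1..n. \<Sum>i'=i+1..n.
                   real n * (real n2 - 1) * ee i i' - (real n - 1) * real n2 * e i * e i'))"
proof -
  interpret random_holdout_split M L yhat y S e ee n n1 n2
    using n1_lt n2_def S_range S_meas S_unif L_int LL_int cond_e cond_ee
    by (intro random_holdout_split.intro[OF P] random_holdout_split_axioms.intro) simp_all
  show ?thesis
    using expectation_holdout_error variance_holdout_error by (rule conjI)
qed

end
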